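(* For a commutative ring $R$ with identity the following are equivalent: (1) $R/\mathfrak{p}\oplus R/\mathfrak{p}'$ is a strongly CS $R$-module for every two distinct minimal prime ideals $\mathfrak{p}$ and $\mathfrak{p}'$ of $R$; (2) $R$ is an mp-ring and idempotents lift modulo $\mathfrak{p}\cap\mathfrak{p}'$ for every two distinct minimal prime ideals $\mathfrak{p}$ and $\mathfrak{p}'$ of $R$; (3) $R$ is a purified ring.
   Context: All rings are commutative with identity and all modules are unital. An $R$-module $M$ is strongly CS if for every submodule $N$ of $M$ there exists an idempotent $e=e^2\in R$ such that $N$ is an essential submodule of $eM$. A ring $R$ is an mp-ring if every prime ideal of $R$ contains a unique minimal prime ideal. A ring $R$ is purified if for every two distinct minimal prime ideals $\mathfrak{p},\mathfrak{p}'$ of $R$ there exists an idempotent $e$ of $R$ such that $e\in\mathfrak{p}$ and $1-e\in\mathfrak{p}'$. For a proper ideal $I$ of $R$, idempotents lift modulo $I$ if whenever $r\in R$ satisfies $r-r^2\in I$, there exists $e=e^2\in R$ with $r-e\in I$. *)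

theory Defs
  imports "HOL-Algebra.Module" "HOL-Algebra.Chinese_Remainder"
begin

definition idempotent_in :: "('a, 'm) ring_scheme \<Rightarrow> 'a \<Rightarrow> bool"
  where "idempotent_in R e \<longleftrightarrow> e \<in> carrier R \<and> e \<otimes>\<^bsub>R\<^esub> e = e"

definition minimal_prime :: "'a set \<Rightarrow> ('a, 'm) ring_scheme \<Rightarrow> bool"
  where "minimal_prime P R \<longleftrightarrow>
    primeideal P R \<and> (\<forall>Q. primeideal Q R \<longrightarrow> Q \<subseteq> P \<longrightarrow> Q = P)"

definition mp_ring :: "('a, 'm) ring_scheme \<Rightarrow> bool"
  where "mp_ring R \<longleftrightarrow> cring R \<and>
    (\<forall>Q. primeideal Q R \<longrightarrow> (\<exists>!P. minimal_prime P R \<and> P \<subseteq> Q))"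

definition purified_ring :: "('a, 'm) ring_scheme \<Rightarrow> bool"
  where "purified_ring R \<longleftrightarrow> cring R \<and>
    (\<forall>P P'. minimal_prime P R \<longrightarrow> minimal_prime P' R \<longrightarrow> P \<noteq> P' \<longrightarrow>
      (\<exists>e. idempotent_in R e \<and> e \<in> P \<and> \<one>\<^bsub>R\<^esub> \<ominus>\<^bsub>R\<^esub> e \<in> P'))"

definition idempotents_lift :: "('a, 'm) ring_scheme \<Rightarrow> 'a set \<Rightarrow> bool"
  where "idempotents_lift R I \<longleftrightarrow>
    (\<forall>r \<in> carrier R. r \<ominus>\<^bsub>R\<^esub> r \<otimes>\<^bsub>R\<^esub> r \<in> I \<longrightarrow>
      (\<exists>e. idempotent_in R e \<and> r \<ominus>\<^bsub>R\<^esub> e \<in> I))"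

text \<open>Submodules of the submodule \<open>K\<close> are the submodules of \<open>M\<close> contained in \<open>K\<close>.\<close>

definition essential_submodule ::
    "('a, 'm) ring_scheme \<Rightarrow> ('a, 'b, 'n) module_scheme \<Rightarrow> 'b set \<Rightarrow> 'b set \<Rightarrow> bool"
  where "essential_submodule R M N K \<longleftrightarrow>
    submodule N R M \<and> submodule K R M \<and> N \<subseteq> K \<and>
    (\<forall>L. submodule L R M \<longrightarrow> L \<subseteq> K \<longrightarrow> L \<inter> N = {\<zero>\<^bsub>M\<^esub>} \<longrightarrow> L = {\<zero>\<^bsub>M\<^esub>})"

definition strongly_CS ::
    "('a, 'm) ring_scheme \<Rightarrow> ('a, 'b, 'n) module_scheme \<Rightarrow> bool"
  where "strongly_CS R M \<longleftrightarrow> module R M \<and>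
    (\<forall>N. submodule N R M \<longrightarrow>
      (\<exists>e. idempotent_in R e \<and>
        essential_submodule R M N ((\<lambda>x. e \<odot>\<^bsub>M\<^esub> x) ` carrier M)))"

definition quot_module :: "('a, 'm) ring_scheme \<Rightarrow> 'a set \<Rightarrow> ('a, 'a set) module"
  where "quot_module R I = ring.extend (R Quot I)
    \<lparr> smult = (\<lambda>r X. (I +>\<^bsub>R\<^esub> r) \<otimes>\<^bsub>R Quot I\<^esub> X) \<rparr>"

text \<open>Records of type \<open>module\<close> extend ring records. The ring multiplication and unit that
  the direct sum inherits from \<^const>\<open>RDirProd\<close> are not part of the module structure.\<close>

definition module_sum ::
    "('a, 'b, 'm) module_scheme \<Rightarrow> ('a, 'c, 'n) module_scheme \<Rightarrow> ('a, 'b \<times> 'c) module"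
  where "module_sum M N = ring.extend (RDirProd M N)
    \<lparr> smult = (\<lambda>r (x, y). (r \<odot>\<^bsub>M\<^esub> x, r \<odot>\<^bsub>N\<^esub> y)) \<rparr>"

lemma (in cring) quot_module_is_module:
  assumes "ideal I R"
  shows "module R (quot_module R I)"
proof -
  interpret I: ideal I R by fact
  interpret Q: cring "R Quot I" using I.quotient_is_cring is_cring by blast
  note h = I.rcos_ring_hom
  have sel: "carrier (quot_module R I) = carrier (R Quot I)"
    "add (quot_module R I) = add (R Quot I)" "zero (quot_module R I) = zero (R Quot I)"
    "\<And>r X. smult (quot_module R I) r X = (I +> r) \<otimes>\<^bsub>R Quot I\<^esub> X"
    by (simp_all add: quot_module_def ring.defs)
  have ag: "abelian_group (quot_module R I)"
    by (rule abelian_groupI) (simp_all add: sel Q.a_ac Q.add.l_inv_ex)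
  show ?thesis
    by (rule moduleI)
      (auto simp: is_cring ag sel ring_hom_closed[OF h] ring_hom_add[OF h] ring_hom_mult[OF h]
        ring_hom_one[OF h] Q.l_distr Q.r_distr Q.m_assoc)
qed

lemma module_sum_is_module:
  assumes "module R M" "module R N"
  shows "module R (module_sum M N)"
proof -
  interpret M: module R M by fact
  interpret N: module R N by fact
  have sel: "carrier (module_sum M N) = carrier M \<times> carrier N"
    "zero (module_sum M N) = (zero M, zero N)"
    "\<And>x y x' y'. add (module_sum M N) (x, y) (x', y') = (x \<oplus>\<^bsub>M\<^esub> x', y \<oplus>\<^bsub>N\<^esub> y')"
    "\<And>r x y. smult (module_sum M N) r (x, y) = (r \<odot>\<^bsub>M\<^esub> x, r \<odot>\<^bsub>N\<^esub> y)"
    by (simp_all add: module_sum_def ring.defs monoid.defs RDirProd_def DirProd_def)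
  have ag: "abelian_group (module_sum M N)"
  proof (rule abelian_groupI)
    fix z assume "z \<in> carrier (module_sum M N)"
    then show "\<exists>w\<in>carrier (module_sum M N). w \<oplus>\<^bsub>module_sum M N\<^esub> z = \<zero>\<^bsub>module_sum M N\<^esub>"
      by (auto simp: sel intro!: bexI[of _ "(\<ominus>\<^bsub>M\<^esub> fst z, \<ominus>\<^bsub>N\<^esub> snd z)"] M.l_neg N.l_neg)
  qed (auto simp: sel M.M.a_ac N.M.a_ac)
  show ?thesis
    by (rule moduleI)
      (auto simp: ag sel M.R.is_cring M.smult_l_distr N.smult_l_distr M.smult_r_distr
        N.smult_r_distr M.smult_assoc1 N.smult_assoc1)
qed

end

theory Submission
  imports "HOL-Algebra.Ring_Divisibility" Defs
begin

text \<open>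
  Everything turns on an idempotent \<open>e\<close> with \<open>e \<in> P\<close> and \<open>1 - e \<in> P'\<close>. It acts on
  \<open>M = R/P \<oplus> R/P'\<close> as the projection onto \<open>R/P'\<close>, and \<open>1 - e\<close> as the projection onto \<open>R/P\<close>.

  If \<open>M\<close> is strongly CS, then \<open>N = R/P \<oplus> 0\<close> is essential in some \<open>fM\<close>. As \<open>f\<close> fixes \<open>N\<close>,
  we get \<open>1 - f \<in> P\<close>. As \<open>P'\<close> is prime, it contains \<open>f\<close> or \<open>1 - f\<close>; in the latter case \<open>fM = M\<close>,
  and the nonzero submodule \<open>0 \<oplus> R/P'\<close> would meet \<open>N\<close> in \<open>0\<close>. So \<open>f \<in> P'\<close>
  (\<open>strongly_CS_sum_imp_separating_idempotent\<close>).

  Conversely, a separating idempotent splits every submodule \<open>N\<close> of \<open>M\<close> into its two coordinate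
  parts. Both summands are uniform, being \<open>R/P\<close> and \<open>R/P'\<close> for primes, so each part of \<open>N\<close> is zero
  or essential in its summand. The sum of the summands which \<open>N\<close> meets nontrivially is \<open>fM\<close> for some
  \<open>f \<in> {0, e, 1 - e, 1}\<close> (\<open>strongly_CS_if_uniform_split\<close>).

  For the ring-theoretic condition: the mp property says that distinct minimal primes are comaximal,
  because every proper ideal lies in a maximal one. A decomposition \<open>1 = r + s\<close> with \<open>r \<in> P\<close> and
  \<open>s \<in> P'\<close> makes \<open>r\<close> idempotent modulo \<open>P \<inter> P'\<close>, and a lift of \<open>r\<close> separates \<open>P\<close> from \<open>P'\<close>.
  In the other direction a separating idempotent forbids a common prime above \<open>P\<close> and \<open>P'\<close>, and
  an element idempotent modulo \<open>P \<inter> P'\<close> is \<open>0\<close> or \<open>1\<close> modulo each of the two primes, so that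
  one of \<open>0, e, 1 - e, 1\<close> lifts it.
\<close>

section \<open>Idempotents and prime ideals\<close>

lemma (in cring) idempotent_compl:
  assumes "idempotent_in R e"
  shows "idempotent_in R (\<one> \<ominus> e)" "e \<otimes> (\<one> \<ominus> e) = \<zero>" "(\<one> \<ominus> e) \<otimes> e = \<zero>" "\<one> \<ominus> (\<one> \<ominus> e) = e"
proof -
  have e [simp]: "e \<in> carrier R" and ee: "e \<otimes> e = e"
    using assms by (auto simp: idempotent_in_def)
  have "e \<otimes> (\<one> \<ominus> e) = e \<ominus> e \<otimes> e" using e by algebra
  then show 1: "e \<otimes> (\<one> \<ominus> e) = \<zero>" using ee by (simp add: a_minus_def r_neg)
  then show "(\<one> \<ominus> e) \<otimes> e = \<zero>" by (simp add: m_comm)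
  show "\<one> \<ominus> (\<one> \<ominus> e) = e" using e by algebra
  have "(\<one> \<ominus> e) \<otimes> (\<one> \<ominus> e) = (\<one> \<ominus> e) \<ominus> e \<otimes> (\<one> \<ominus> e)" using e by algebra
  also have "\<dots> = \<one> \<ominus> e" unfolding 1 using e by algebra
  finally show "idempotent_in R (\<one> \<ominus> e)" by (simp add: idempotent_in_def)
qed

lemma (in cring) idempotent_zero: "idempotent_in R \<zero>"
  by (simp add: idempotent_in_def)

lemma (in cring) idempotent_one: "idempotent_in R \<one>"
  by (simp add: idempotent_in_def)

lemma (in ideal) diff_closed:
  assumes "a \<in> I" "b \<in> I"
  shows "a \<ominus> b \<in> I"
  using assms by (simp add: a_minus_def)

lemma (in primeideal) one_notin: "\<one> \<notin> I"
  using I_notcarr one_imp_carrier by blast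

lemma (in primeideal) not_both_complementary:
  assumes "e \<in> I" "\<one> \<ominus> e \<in> I"
  shows False
proof -
  have "e \<in> carrier R" using assms(1) by (rule Icarr)
  then have "\<one> = (\<one> \<ominus> e) \<oplus> e" by algebra
  also have "\<dots> \<in> I" using assms by simp
  finally show False using one_notin by blast
qed

lemma (in primeideal) idempotent_mod_cases:
  assumes "r \<in> carrier R" "r \<ominus> r \<otimes> r \<in> I"
  shows "r \<in> I \<or> \<one> \<ominus> r \<in> I"
proof -
  have "r \<ominus> r \<otimes> r = r \<otimes> (\<one> \<ominus> r)" using assms(1) by algebra
  then show ?thesis using assms I_prime[of r "\<one> \<ominus> r"] by simp
qed

lemma (in primeideal) idempotent_cases:
  assumes "idempotent_in R e"
  shows "e \<in> I \<or> \<one> \<ominus> e \<in> I"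
  using assms idempotent_mod_cases[of e] by (simp add: idempotent_in_def a_minus_def r_neg)

section \<open>Maximal ideals above and minimal primes below\<close>

lemma (in ring) proper_ideal_below_maximal:
  assumes "ideal I R" "\<one> \<notin> I"
  shows "\<exists>M. maximalideal M R \<and> I \<subseteq> M"
proof -
  let ?A = "{J. ideal J R \<and> I \<subseteq> J \<and> \<one> \<notin> J}"
  have "\<exists>M\<in>?A. \<forall>J\<in>?A. M \<subseteq> J \<longrightarrow> J = M"
  proof (rule subset_Zorn_nonempty)
    show "?A \<noteq> {}" using assms by blast
  next
    fix C assume C: "C \<noteq> {}" "subset.chain ?A C"
    then have "subset.chain {J. ideal J R} C" unfolding subset_chain_def by blast
    then have "ideal (\<Union>C) R" using chain_Union_is_ideal[of C] C(1) by simp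
    moreover have "I \<subseteq> J \<and> \<one> \<notin> J" if "J \<in> C" for J
      using that C(2) unfolding subset_chain_def by blast
    ultimately show "\<Union>C \<in> ?A" using C(1) by blast
  qed
  then obtain M where "M \<in> ?A" and max: "\<forall>J\<in>?A. M \<subseteq> J \<longrightarrow> J = M" by (rule bexE)
  then have M: "ideal M R" "I \<subseteq> M" "\<one> \<notin> M" by simp_all
  have "maximalideal M R"
  proof (rule maximalidealI[OF M(1)])
    show "carrier R \<noteq> M" using M(3) one_closed by metis
  next
    fix J assume J: "ideal J R" "M \<subseteq> J" "J \<subseteq> carrier R"
    show "J = M \<or> J = carrier R"
    proof (cases "\<one> \<in> J")
      case True
      then show ?thesis using ideal.one_imp_carrier[OF J(1)] by simp
    next
      case False
      then have "J \<in> ?A" using J M(2) by simp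
      then show ?thesis using max J(2) by simp
    qed
  qed
  then show ?thesis using M(2) by blast
qed

text \<open>If \<open>a\<close> and \<open>b\<close> are outside the intersection, they are both outside the smaller of the two
  members of the chain that witness this, so \<open>ab\<close> is outside that prime.\<close>

lemma (in cring) chain_Inter_prime:
  assumes "C \<noteq> {}" "subset.chain {P. primeideal P R} C"
  shows "primeideal (\<Inter>C) R"
proof (rule primeidealI)
  have prime: "primeideal P R" if "P \<in> C" for P
    using that assms(2) unfolding subset_chain_def by blast
  show "ideal (\<Inter>C) R"
    using assms(1) prime by (intro i_Intersect) (auto intro: primeideal.axioms(1))
  show "cring R" by (rule is_cring)
  show "carrier R \<noteq> \<Inter>C"
    using assms(1) prime primeideal.one_notin by blast
  fix a b assume ab: "a \<in> carrier R" "b \<in> carrier R" "a \<otimes> b \<in> \<Inter>C"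
  show "a \<in> \<Inter>C \<or> b \<in> \<Inter>C"
  proof (rule ccontr)
    assume "\<not> ?thesis"
    then obtain P Q where PQ: "P \<in> C" "a \<notin> P" "Q \<in> C" "b \<notin> Q" by blast
    then have "P \<subseteq> Q \<or> Q \<subseteq> P" using assms(2) unfolding subset_chain_def by blast
    then obtain S where S: "S \<in> C" "a \<notin> S" "b \<notin> S" using PQ by blast
    then show False using primeideal.I_prime[OF prime[OF S(1)] ab(1,2)] ab(3) by blast
  qed
qed

lemma (in cring) minimal_prime_below:
  assumes "primeideal Q R"
  shows "\<exists>P. minimal_prime P R \<and> P \<subseteq> Q"
proof -
  \<comment> \<open>A descending chain of primes is an ascending chain of complements, where Zorn's lemma applies.\<close>
  let ?A = "{- P | P. primeideal P R \<and> P \<subseteq> Q}"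
  have "\<exists>M\<in>?A. \<forall>X\<in>?A. M \<subseteq> X \<longrightarrow> X = M"
  proof (rule subset_Zorn_nonempty)
    show "?A \<noteq> {}" using assms by blast
  next
    fix C assume C: "C \<noteq> {}" "subset.chain ?A C"
    let ?D = "uminus ` C"
    have CA: "primeideal (- X) R \<and> - X \<subseteq> Q" if "X \<in> C" for X
    proof -
      have "X \<in> ?A" using that C(2) unfolding subset_chain_def by blast
      then show ?thesis by auto
    qed
    have "\<forall>X\<in>C. \<forall>Y\<in>C. X \<subseteq> Y \<or> Y \<subseteq> X"
      using C(2) unfolding subset_chain_def by (rule conjunct2)
    then have "\<forall>P\<in>?D. \<forall>P'\<in>?D. P \<subseteq> P' \<or> P' \<subseteq> P"
      unfolding ball_simps Compl_subset_Compl_iff by blast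
    moreover have "?D \<subseteq> {P. primeideal P R}" using CA by blast
    ultimately have "subset.chain {P. primeideal P R} ?D"
      unfolding subset_chain_def by blast
    then have "primeideal (\<Inter>?D) R" using chain_Inter_prime C(1) by simp
    moreover have "\<Inter>?D \<subseteq> Q" using C(1) CA by blast
    moreover have "\<Union>C = - \<Inter>?D" by auto
    ultimately show "\<Union>C \<in> ?A" by (intro CollectI exI[of _ "\<Inter>?D"]) simp
  qed
  then obtain M where M: "M \<in> ?A" and max: "\<forall>X\<in>?A. M \<subseteq> X \<longrightarrow> X = M" by (rule bexE)
  then obtain P where P: "primeideal P R" "P \<subseteq> Q" "M = - P" by auto
  have "P' = P" if P': "primeideal P' R" "P' \<subseteq> P" for P'
  proof -
    have "- P' \<in> ?A" using P' P(2) by auto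
    with max have "M \<subseteq> - P' \<longrightarrow> - P' = M" by (rule bspec)
    then have "- P' = - P" using P'(2) unfolding P(3) by blast
    then show ?thesis by simp
  qed
  then show ?thesis using P unfolding minimal_prime_def by blast
qed

section \<open>Separating idempotents in the ring\<close>

definition separating_idempotent :: "('a, 'm) ring_scheme \<Rightarrow> 'a set \<Rightarrow> 'a set \<Rightarrow> 'a \<Rightarrow> bool"
  where "separating_idempotent R P P' e \<longleftrightarrow>
    idempotent_in R e \<and> e \<in> P \<and> \<one>\<^bsub>R\<^esub> \<ominus>\<^bsub>R\<^esub> e \<in> P'"

lemma (in cring) separating_idempotent_sym:
  assumes "separating_idempotent R P P' e"
  shows "separating_idempotent R P' P (\<one> \<ominus> e)"
  using assms idempotent_compl[of e] by (simp add: separating_idempotent_def)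

lemma (in cring) mp_imp_comaximal:
  assumes mp: "mp_ring R" and P: "minimal_prime P R" and P': "minimal_prime P' R" and "P \<noteq> P'"
  shows "\<exists>r. r \<in> P \<and> \<one> \<ominus> r \<in> P'"
proof -
  interpret P: primeideal P R using P by (simp add: minimal_prime_def)
  interpret P': primeideal P' R using P' by (simp add: minimal_prime_def)
  have id: "ideal (P <+>\<^bsub>R\<^esub> P') R" by (rule add_ideals[OF P.is_ideal P'.is_ideal])
  have sum: "a \<oplus> b \<in> P <+>\<^bsub>R\<^esub> P'" if "a \<in> P" "b \<in> P'" for a b
    using that unfolding set_add_def' by blast
  have sub: "P \<subseteq> P <+>\<^bsub>R\<^esub> P'" "P' \<subseteq> P <+>\<^bsub>R\<^esub> P'"
    using sum[OF _ P'.zero_closed] sum[OF P.zero_closed] P.Icarr P'.Icarr by auto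
  have "\<one> \<in> P <+>\<^bsub>R\<^esub> P'"
  proof (rule ccontr)
    assume "\<one> \<notin> P <+>\<^bsub>R\<^esub> P'"
    then obtain M where M: "maximalideal M R" "P <+>\<^bsub>R\<^esub> P' \<subseteq> M"
      using proper_ideal_below_maximal[OF id] by blast
    then have "\<exists>!P. minimal_prime P R \<and> P \<subseteq> M"
      using maximalideal_prime mp by (simp add: mp_ring_def)
    then show False using P P' sub M(2) \<open>P \<noteq> P'\<close> by blast
  qed
  then obtain r s where rs: "r \<in> P" "s \<in> P'" "\<one> = r \<oplus> s"
    unfolding set_add_def' by blast
  have "\<one> \<ominus> r = s" unfolding rs(3) using P.Icarr[OF rs(1)] P'.Icarr[OF rs(2)] by algebra
  then show ?thesis using rs by blast
qed

text \<open>With \<open>r \<in> P\<close> and \<open>1 - r \<in> P'\<close>, the element \<open>r(1 - r)\<close> lies in both ideals; a lift \<open>e\<close> of \<open>r\<close>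
  is congruent to \<open>r\<close> modulo each of them.\<close>

lemma (in cring) comaximal_lift_imp_separating:
  assumes P: "ideal P R" and P': "ideal P' R" and lift: "idempotents_lift R (P \<inter> P')"
    and r: "r \<in> P" "\<one> \<ominus> r \<in> P'"
  shows "\<exists>e. separating_idempotent R P P' e"
proof -
  interpret P: ideal P R by fact
  interpret P': ideal P' R by fact
  have rc: "r \<in> carrier R" using r(1) by (rule P.Icarr)
  have "r \<ominus> r \<otimes> r = r \<otimes> (\<one> \<ominus> r)" using rc by algebra
  then have "r \<ominus> r \<otimes> r \<in> P \<inter> P'"
    using P.I_r_closed[OF r(1), of "\<one> \<ominus> r"] P'.I_l_closed[OF r(2) rc] rc by simp
  then obtain e where e: "idempotent_in R e" "r \<ominus> e \<in> P" "r \<ominus> e \<in> P'"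
    using lift rc by (auto simp: idempotents_lift_def)
  then have ec: "e \<in> carrier R" by (simp add: idempotent_in_def)
  have "e = r \<ominus> (r \<ominus> e)" using ec rc by algebra
  then have "e \<in> P" using P.diff_closed[OF r(1) e(2)] by simp
  have "\<one> \<ominus> e = (\<one> \<ominus> r) \<oplus> (r \<ominus> e)" using ec rc by algebra
  then have "\<one> \<ominus> e \<in> P'" using r(2) e(3) by simp
  then show ?thesis using e(1) \<open>e \<in> P\<close> by (auto simp: separating_idempotent_def)
qed

text \<open>An element which is idempotent modulo \<open>P \<inter> P'\<close> is congruent to \<open>0\<close> or \<open>1\<close> modulo each prime,
  and each of the four patterns of residues is realised by one of \<open>0, 1, e, 1 - e\<close>.\<close>

lemma (in cring) separating_imp_lift:
  assumes P: "primeideal P R" and P': "primeideal P' R" and e: "separating_idempotent R P P' e"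
  shows "idempotents_lift R (P \<inter> P')"
  unfolding idempotents_lift_def
proof (intro ballI impI)
  interpret P: primeideal P R by fact
  interpret P': primeideal P' R by fact
  fix r assume r: "r \<in> carrier R" "r \<ominus> r \<otimes> r \<in> P \<inter> P'"
  have e': "idempotent_in R e" "e \<in> carrier R" "e \<in> P" "\<one> \<ominus> e \<in> P'"
    using e by (auto simp: separating_idempotent_def idempotent_in_def)
  have both1: "r \<ominus> f \<in> J" if "ideal J R" "\<one> \<ominus> r \<in> J" "\<one> \<ominus> f \<in> J" "f \<in> carrier R" for J f
  proof -
    have "r \<ominus> f = (\<one> \<ominus> f) \<ominus> (\<one> \<ominus> r)" using r(1) that(4) by algebra
    then show ?thesis using ideal.diff_closed[OF that(1,3,2)] by simp
  qed
  have cc: "\<one> \<ominus> (\<one> \<ominus> e) \<in> P" using e' idempotent_compl(4) by simp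
  have z: "\<one> \<ominus> \<one> \<in> P" "\<one> \<ominus> \<one> \<in> P'" by (simp_all add: a_minus_def r_neg)
  consider "r \<in> P" "r \<in> P'" | "\<one> \<ominus> r \<in> P" "\<one> \<ominus> r \<in> P'"
    | "r \<in> P" "\<one> \<ominus> r \<in> P'" | "\<one> \<ominus> r \<in> P" "r \<in> P'"
    using P.idempotent_mod_cases P'.idempotent_mod_cases r by blast
  then show "\<exists>f. idempotent_in R f \<and> r \<ominus> f \<in> P \<inter> P'"
  proof cases
    case 1
    then show ?thesis using idempotent_zero P.diff_closed P'.diff_closed by (intro exI[of _ \<zero>]) simp
  next
    case 2
    then show ?thesis using idempotent_one both1 P.is_ideal P'.is_ideal z
      by (intro exI[of _ \<one>]) simp
  next
    case 3
    then show ?thesis using e' both1 P.diff_closed P'.is_ideal by (intro exI[of _ e]) simp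
  next
    case 4
    then show ?thesis using e' cc idempotent_compl(1) both1 P'.diff_closed P.is_ideal
      by (intro exI[of _ "\<one> \<ominus> e"]) simp
  qed
qed

lemma (in cring) purified_iff:
  "purified_ring R \<longleftrightarrow> (\<forall>P P'. minimal_prime P R \<longrightarrow> minimal_prime P' R \<longrightarrow> P \<noteq> P' \<longrightarrow>
    (\<exists>e. separating_idempotent R P P' e))"
  by (simp add: purified_ring_def separating_idempotent_def is_cring)

lemma (in cring) mp_and_lift_iff_purified:
  "(mp_ring R \<and> (\<forall>P P'. minimal_prime P R \<longrightarrow> minimal_prime P' R \<longrightarrow> P \<noteq> P' \<longrightarrow>
      idempotents_lift R (P \<inter> P'))) \<longleftrightarrow> purified_ring R" (is "?mp \<and> ?lift \<longleftrightarrow> _")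
proof
  assume A: "?mp \<and> ?lift"
  have "\<exists>e. separating_idempotent R P P' e"
    if PP: "minimal_prime P R" "minimal_prime P' R" "P \<noteq> P'" for P P'
  proof -
    have "ideal P R" "ideal P' R"
      using PP by (auto simp: minimal_prime_def intro: primeideal.axioms(1))
    then show ?thesis using comaximal_lift_imp_separating mp_imp_comaximal A PP by meson
  qed
  then show "purified_ring R" unfolding purified_iff by blast
next
  assume pur: "purified_ring R"
  have "\<exists>!P. minimal_prime P R \<and> P \<subseteq> Q" if Q: "primeideal Q R" for Q
  proof -
    have "P = P'" if PP: "minimal_prime P R" "P \<subseteq> Q" "minimal_prime P' R" "P' \<subseteq> Q" for P P'
    proof (rule ccontr)
      assume "P \<noteq> P'"
      then obtain e where "separating_idempotent R P P' e" using pur PP unfolding purified_iff by blast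
      then show False using primeideal.not_both_complementary[OF Q] PP
        unfolding separating_idempotent_def by blast
    qed
    then show ?thesis using minimal_prime_below[OF Q] by blast
  qed
  then have ?mp by (simp add: mp_ring_def is_cring)
  moreover have ?lift
    using pur separating_imp_lift unfolding purified_iff minimal_prime_def by blast
  ultimately show "?mp \<and> ?lift" ..
qed

section \<open>Modules split by an idempotent into two uniform parts\<close>

text \<open>Uniformity of a submodule, stated on elements: any two nonzero cyclic submodules of \<open>U\<close> have
  a nonzero common element.\<close>

definition uniform_part :: "('a, 'm) ring_scheme \<Rightarrow> ('a, 'b, 'n) module_scheme \<Rightarrow> 'b set \<Rightarrow> bool"
  where "uniform_part R M U \<longleftrightarrow> (\<forall>u\<in>U. \<forall>v\<in>U. u \<noteq> \<zero>\<^bsub>M\<^esub> \<longrightarrow> v \<noteq> \<zero>\<^bsub>M\<^esub> \<longrightarrow>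
    (\<exists>r\<in>carrier R. \<exists>s\<in>carrier R. r \<odot>\<^bsub>M\<^esub> u = s \<odot>\<^bsub>M\<^esub> v \<and> r \<odot>\<^bsub>M\<^esub> u \<noteq> \<zero>\<^bsub>M\<^esub>))"

lemma uniform_part_disjoint:
  assumes U: "uniform_part R M U" and L: "submodule L R M" and N: "submodule N R M"
    and LN: "L \<inter> N = {\<zero>\<^bsub>M\<^esub>}" and n: "n \<in> N" "n \<in> U" "n \<noteq> \<zero>\<^bsub>M\<^esub>" and l: "l \<in> L" "l \<in> U"
  shows "l = \<zero>\<^bsub>M\<^esub>"
proof (rule ccontr)
  assume "l \<noteq> \<zero>\<^bsub>M\<^esub>"
  then obtain r s where rs: "r \<in> carrier R" "s \<in> carrier R"
    "r \<odot>\<^bsub>M\<^esub> l = s \<odot>\<^bsub>M\<^esub> n" "r \<odot>\<^bsub>M\<^esub> l \<noteq> \<zero>\<^bsub>M\<^esub>"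
    using U n l unfolding uniform_part_def by blast
  then have "r \<odot>\<^bsub>M\<^esub> l \<in> L \<inter> N"
    using submodule.smult_closed[OF L rs(1) l(1)] submodule.smult_closed[OF N rs(2) n(1)] by simp
  then show False using LN rs(4) by blast
qed

lemma (in module) smult_image_submodule:
  assumes r: "r \<in> carrier R"
  shows "submodule ((\<lambda>x. r \<odot>\<^bsub>M\<^esub> x) ` carrier M) R M"
proof (rule submoduleI)
  show "\<zero>\<^bsub>M\<^esub> \<in> (\<lambda>x. r \<odot>\<^bsub>M\<^esub> x) ` carrier M"
    using r by (intro image_eqI[of _ _ "\<zero>\<^bsub>M\<^esub>"]) auto
next
  fix a assume "a \<in> (\<lambda>x. r \<odot>\<^bsub>M\<^esub> x) ` carrier M"
  then obtain x where "x \<in> carrier M" "a = r \<odot>\<^bsub>M\<^esub> x" by blast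
  then show "\<ominus>\<^bsub>M\<^esub> a \<in> (\<lambda>x. r \<odot>\<^bsub>M\<^esub> x) ` carrier M"
    using r by (intro image_eqI[of _ _ "\<ominus>\<^bsub>M\<^esub> x"]) (auto simp: smult_r_minus)
next
  fix a b assume "a \<in> (\<lambda>x. r \<odot>\<^bsub>M\<^esub> x) ` carrier M" "b \<in> (\<lambda>x. r \<odot>\<^bsub>M\<^esub> x) ` carrier M"
  then obtain x y where "x \<in> carrier M" "a = r \<odot>\<^bsub>M\<^esub> x" "y \<in> carrier M" "b = r \<odot>\<^bsub>M\<^esub> y" by blast
  then show "a \<oplus>\<^bsub>M\<^esub> b \<in> (\<lambda>x. r \<odot>\<^bsub>M\<^esub> x) ` carrier M"
    using r by (intro image_eqI[of _ _ "x \<oplus>\<^bsub>M\<^esub> y"]) (auto simp: smult_r_distr)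
next
  fix s a assume s: "s \<in> carrier R" and "a \<in> (\<lambda>x. r \<odot>\<^bsub>M\<^esub> x) ` carrier M"
  then obtain x where "x \<in> carrier M" "a = r \<odot>\<^bsub>M\<^esub> x" by blast
  then show "s \<odot>\<^bsub>M\<^esub> a \<in> (\<lambda>x. r \<odot>\<^bsub>M\<^esub> x) ` carrier M"
    using r s by (intro image_eqI[of _ _ "s \<odot>\<^bsub>M\<^esub> x"]) (auto simp: smult_assoc1[symmetric] R.m_comm)
qed (use r in auto)

text \<open>Write \<open>g\<close> for \<open>e\<close> or \<open>1 - e\<close>. For a submodule \<open>N\<close> keep those \<open>g\<close> with \<open>gN \<noteq> 0\<close> and let \<open>f\<close> be
  their sum, so that \<open>f\<close> fixes \<open>N\<close>. If \<open>L \<subseteq> fM\<close> meets \<open>N\<close> trivially, then \<open>gL = 0\<close> for both \<open>g\<close>: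
  for the discarded ones because \<open>gf = 0\<close>, for the others because \<open>gL\<close> and \<open>gN \<noteq> 0\<close> are
  submodules of the uniform \<open>gM\<close>.\<close>

lemma (in module) strongly_CS_if_uniform_split:
  assumes e: "idempotent_in R e"
    and U: "uniform_part R M ((\<lambda>x. e \<odot>\<^bsub>M\<^esub> x) ` carrier M)"
      "uniform_part R M ((\<lambda>x. (\<one>\<^bsub>R\<^esub> \<ominus>\<^bsub>R\<^esub> e) \<odot>\<^bsub>M\<^esub> x) ` carrier M)"
  shows "strongly_CS R M"
  unfolding strongly_CS_def
proof (intro conjI allI impI)
  show "module R M" by (rule module_axioms)
next
  fix N assume N: "submodule N R M"
  note NC = submoduleE(1)[OF N]
  define e' where "e' = \<one>\<^bsub>R\<^esub> \<ominus>\<^bsub>R\<^esub> e"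
  define keep where "keep = (\<lambda>g. if \<forall>n\<in>N. g \<odot>\<^bsub>M\<^esub> n = \<zero>\<^bsub>M\<^esub> then \<zero>\<^bsub>R\<^esub> else g)"
  define f where "f = keep e \<oplus>\<^bsub>R\<^esub> keep e'"
  have ec [simp]: "e \<in> carrier R" "e' \<in> carrier R" using e by (auto simp: idempotent_in_def e'_def)
  have mult [simp]: "e \<otimes>\<^bsub>R\<^esub> e = e" "e' \<otimes>\<^bsub>R\<^esub> e' = e'" "e \<otimes>\<^bsub>R\<^esub> e' = \<zero>\<^bsub>R\<^esub>" "e' \<otimes>\<^bsub>R\<^esub> e = \<zero>\<^bsub>R\<^esub>"
    using e R.idempotent_compl[OF e] by (auto simp: idempotent_in_def e'_def)
  have one: "e \<oplus>\<^bsub>R\<^esub> e' = \<one>\<^bsub>R\<^esub>" unfolding e'_def using ec(1) by algebra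
  have keepc [simp]: "keep e \<in> carrier R" "keep e' \<in> carrier R" by (auto simp: keep_def)
  have fc [simp]: "f \<in> carrier R" by (simp add: f_def)
  have gf: "e \<otimes>\<^bsub>R\<^esub> f = keep e" "e' \<otimes>\<^bsub>R\<^esub> f = keep e'"
    by (auto simp: f_def keep_def R.r_distr)
  have "idempotent_in R f"
    by (auto simp: idempotent_in_def f_def keep_def R.r_distr R.l_distr)
  have split: "x = e \<odot>\<^bsub>M\<^esub> x \<oplus>\<^bsub>M\<^esub> e' \<odot>\<^bsub>M\<^esub> x" if "x \<in> carrier M" for x
    using that one smult_l_distr[of e e' x] smult_one by simp
  have keepN: "keep g \<odot>\<^bsub>M\<^esub> n = g \<odot>\<^bsub>M\<^esub> n" if "n \<in> N" for g n
    using that NC by (auto simp: keep_def)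
  have fN: "f \<odot>\<^bsub>M\<^esub> n = n" if n: "n \<in> N" for n
  proof -
    have "n \<in> carrier M" using n NC by blast
    then show ?thesis using n split[of n] by (simp add: f_def smult_l_distr keepN)
  qed
  have essential: "L = {\<zero>\<^bsub>M\<^esub>}"
    if L: "submodule L R M" "L \<subseteq> (\<lambda>x. f \<odot>\<^bsub>M\<^esub> x) ` carrier M" and LN: "L \<inter> N = {\<zero>\<^bsub>M\<^esub>}" for L
  proof -
    note LC = submoduleE(1)[OF L(1)]
    have part: "g \<odot>\<^bsub>M\<^esub> l = \<zero>\<^bsub>M\<^esub>"
      if l: "l \<in> L" and g: "g \<in> carrier R" "g \<otimes>\<^bsub>R\<^esub> f = keep g"
        and Ug: "uniform_part R M ((\<lambda>x. g \<odot>\<^bsub>M\<^esub> x) ` carrier M)" for g l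
    proof (cases "\<forall>n\<in>N. g \<odot>\<^bsub>M\<^esub> n = \<zero>\<^bsub>M\<^esub>")
      case True
      then have "g \<otimes>\<^bsub>R\<^esub> f = \<zero>\<^bsub>R\<^esub>" using g by (simp add: keep_def)
      moreover obtain x where "x \<in> carrier M" "l = f \<odot>\<^bsub>M\<^esub> x" using l L(2) by blast
      ultimately show ?thesis using g by (simp add: smult_assoc1[symmetric])
    next
      case False
      then obtain n where n: "n \<in> N" "g \<odot>\<^bsub>M\<^esub> n \<noteq> \<zero>\<^bsub>M\<^esub>" by blast
      show ?thesis
      proof (rule uniform_part_disjoint[OF Ug L(1) N LN])
        show "g \<odot>\<^bsub>M\<^esub> n \<in> N" by (rule submodule.smult_closed[OF N g(1) n(1)])
        show "g \<odot>\<^bsub>M\<^esub> l \<in> L" by (rule submodule.smult_closed[OF L(1) g(1) l])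
      qed (use n l NC LC in auto)
    qed
    have "l = \<zero>\<^bsub>M\<^esub>" if "l \<in> L" for l
      using split[of l] part[OF that ec(1) gf(1) U(1)] part[OF that ec(2) gf(2)] U(2) that LC
      unfolding e'_def[symmetric] by auto
    then show ?thesis using LN by blast
  qed
  have "N \<subseteq> (\<lambda>x. f \<odot>\<^bsub>M\<^esub> x) ` carrier M"
  proof
    fix n assume "n \<in> N"
    then show "n \<in> (\<lambda>x. f \<odot>\<^bsub>M\<^esub> x) ` carrier M"
      using NC fN by (intro image_eqI[of _ _ n]) auto
  qed
  then have "essential_submodule R M N ((\<lambda>x. f \<odot>\<^bsub>M\<^esub> x) ` carrier M)"
    unfolding essential_submodule_def using N essential smult_image_submodule[OF fc] by blast
  then show "\<exists>e. idempotent_in R e \<and> essential_submodule R M N ((\<lambda>x. e \<odot>\<^bsub>M\<^esub> x) ` carrier M)"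
    using \<open>idempotent_in R f\<close> by blast
qed

section \<open>Sums of two residue domains\<close>

lemma module_sum_sel:
  "carrier (module_sum M N) = carrier M \<times> carrier N"
  "\<zero>\<^bsub>module_sum M N\<^esub> = (\<zero>\<^bsub>M\<^esub>, \<zero>\<^bsub>N\<^esub>)"
  "(x, y) \<oplus>\<^bsub>module_sum M N\<^esub> (x', y') = (x \<oplus>\<^bsub>M\<^esub> x', y \<oplus>\<^bsub>N\<^esub> y')"
  "r \<odot>\<^bsub>module_sum M N\<^esub> (x, y) = (r \<odot>\<^bsub>M\<^esub> x, r \<odot>\<^bsub>N\<^esub> y)"
  by (simp_all add: module_sum_def ring.defs monoid.defs RDirProd_def DirProd_def)

lemma quot_module_zero: "\<zero>\<^bsub>quot_module R I\<^esub> = I"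
  by (simp add: quot_module_def ring.defs FactRing_def)

lemma quot_module_carrier: "carrier (quot_module R I) = (\<Union>a\<in>carrier R. {I +>\<^bsub>R\<^esub> a})"
  by (simp add: quot_module_def ring.defs FactRing_def A_RCOSETS_def RCOSETS_def a_r_coset_def)

lemma (in ideal) quot_module_carrierE:
  assumes "X \<in> carrier (quot_module R I)"
  obtains a where "a \<in> carrier R" "X = I +> a"
  using assms unfolding quot_module_carrier by blast

lemma (in ideal) coset_in_quot_module:
  assumes "a \<in> carrier R"
  shows "I +> a \<in> carrier (quot_module R I)"
  using assms unfolding quot_module_carrier by blast

lemma (in ideal) quot_module_smult:
  assumes "r \<in> carrier R" "a \<in> carrier R"
  shows "r \<odot>\<^bsub>quot_module R I\<^esub> (I +> a) = I +> (r \<otimes> a)"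
  using assms by (simp add: quot_module_def ring.defs FactRing_def rcoset_mult_add)

lemma (in ideal) coset_eq_zero_iff:
  assumes "a \<in> carrier R"
  shows "I +> a = I \<longleftrightarrow> a \<in> I"
  using assms rcos_const_imp_mem a_rcos_const by blast

lemma (in ideal) quot_module_smult_zero:
  assumes "r \<in> I" "X \<in> carrier (quot_module R I)"
  shows "r \<odot>\<^bsub>quot_module R I\<^esub> X = I"
  using assms quot_module_carrierE[OF assms(2)]
  by (metis Icarr I_r_closed a_rcos_const quot_module_smult)

lemma (in ideal) quot_module_smult_id:
  assumes "r \<in> carrier R" "\<one> \<ominus> r \<in> I" "X \<in> carrier (quot_module R I)"
  shows "r \<odot>\<^bsub>quot_module R I\<^esub> X = X"
proof -
  obtain a where a: "a \<in> carrier R" "X = I +> a" using quot_module_carrierE[OF assms(3)] .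
  have "r \<otimes> a \<ominus> a = \<ominus> ((\<one> \<ominus> r) \<otimes> a)" using assms(1) a(1) by algebra
  also have "\<dots> \<in> I" using I_r_closed[OF assms(2) a(1)] by simp
  finally have "I +> (r \<otimes> a) = I +> a"
    using quotient_eq_iff_same_a_r_cos[OF is_ideal] assms(1) a(1) by simp
  then show ?thesis using a assms(1) by (simp add: quot_module_smult)
qed

text \<open>Nonzero residues \<open>a\<close> and \<open>b\<close> have the common multiple \<open>ab\<close>, which is nonzero because \<open>I\<close> is
  prime.\<close>

lemma (in primeideal) quot_module_uniform:
  "uniform_part R (quot_module R I) (carrier (quot_module R I))"
  unfolding uniform_part_def
proof (intro ballI impI)
  fix X Y assume X: "X \<in> carrier (quot_module R I)" "X \<noteq> \<zero>\<^bsub>quot_module R I\<^esub>"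
    and Y: "Y \<in> carrier (quot_module R I)" "Y \<noteq> \<zero>\<^bsub>quot_module R I\<^esub>"
  obtain a where a: "a \<in> carrier R" "X = I +> a" using quot_module_carrierE[OF X(1)] .
  obtain b where b: "b \<in> carrier R" "Y = I +> b" using quot_module_carrierE[OF Y(1)] .
  have "a \<notin> I" "b \<notin> I" using a b X Y by (simp_all add: quot_module_zero coset_eq_zero_iff)
  then have "b \<otimes> a \<notin> I" using I_prime a b by blast
  then have "b \<odot>\<^bsub>quot_module R I\<^esub> X = a \<odot>\<^bsub>quot_module R I\<^esub> Y \<and>
      b \<odot>\<^bsub>quot_module R I\<^esub> X \<noteq> \<zero>\<^bsub>quot_module R I\<^esub>"
    using a b by (simp add: quot_module_smult quot_module_zero coset_eq_zero_iff m_comm)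
  then show "\<exists>r\<in>carrier R. \<exists>s\<in>carrier R. r \<odot>\<^bsub>quot_module R I\<^esub> X = s \<odot>\<^bsub>quot_module R I\<^esub> Y \<and>
      r \<odot>\<^bsub>quot_module R I\<^esub> X \<noteq> \<zero>\<^bsub>quot_module R I\<^esub>"
    using a b by blast
qed

lemma uniform_part_sum_left:
  assumes "module R N" "uniform_part R M (carrier M)"
  shows "uniform_part R (module_sum M N) (carrier M \<times> {\<zero>\<^bsub>N\<^esub>})"
    (is "uniform_part R _ ?U")
  unfolding uniform_part_def
proof (intro ballI impI)
  interpret module R N by (rule assms(1))
  fix u v assume "u \<in> ?U" "v \<in> ?U" "u \<noteq> \<zero>\<^bsub>module_sum M N\<^esub>" "v \<noteq> \<zero>\<^bsub>module_sum M N\<^esub>"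
  then obtain x y where xy: "u = (x, \<zero>\<^bsub>N\<^esub>)" "v = (y, \<zero>\<^bsub>N\<^esub>)" "x \<in> carrier M" "y \<in> carrier M"
    "x \<noteq> \<zero>\<^bsub>M\<^esub>" "y \<noteq> \<zero>\<^bsub>M\<^esub>"
    by (auto simp: module_sum_sel)
  then obtain r s where "r \<in> carrier R" "s \<in> carrier R"
    "r \<odot>\<^bsub>M\<^esub> x = s \<odot>\<^bsub>M\<^esub> y" "r \<odot>\<^bsub>M\<^esub> x \<noteq> \<zero>\<^bsub>M\<^esub>"
    using assms(2) unfolding uniform_part_def by blast
  then show "\<exists>r\<in>carrier R. \<exists>s\<in>carrier R.
      r \<odot>\<^bsub>module_sum M N\<^esub> u = s \<odot>\<^bsub>module_sum M N\<^esub> v \<and>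
      r \<odot>\<^bsub>module_sum M N\<^esub> u \<noteq> \<zero>\<^bsub>module_sum M N\<^esub>"
    by (intro bexI[of _ r] bexI[of _ s]) (simp_all add: xy module_sum_sel)
qed

lemma uniform_part_sum_right:
  assumes "module R M" "uniform_part R N (carrier N)"
  shows "uniform_part R (module_sum M N) ({\<zero>\<^bsub>M\<^esub>} \<times> carrier N)"
    (is "uniform_part R _ ?U")
  unfolding uniform_part_def
proof (intro ballI impI)
  interpret module R M by (rule assms(1))
  fix u v assume "u \<in> ?U" "v \<in> ?U" "u \<noteq> \<zero>\<^bsub>module_sum M N\<^esub>" "v \<noteq> \<zero>\<^bsub>module_sum M N\<^esub>"
  then obtain x y where xy: "u = (\<zero>\<^bsub>M\<^esub>, x)" "v = (\<zero>\<^bsub>M\<^esub>, y)" "x \<in> carrier N" "y \<in> carrier N"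
    "x \<noteq> \<zero>\<^bsub>N\<^esub>" "y \<noteq> \<zero>\<^bsub>N\<^esub>"
    by (auto simp: module_sum_sel)
  then obtain r s where "r \<in> carrier R" "s \<in> carrier R"
    "r \<odot>\<^bsub>N\<^esub> x = s \<odot>\<^bsub>N\<^esub> y" "r \<odot>\<^bsub>N\<^esub> x \<noteq> \<zero>\<^bsub>N\<^esub>"
    using assms(2) unfolding uniform_part_def by blast
  then show "\<exists>r\<in>carrier R. \<exists>s\<in>carrier R.
      r \<odot>\<^bsub>module_sum M N\<^esub> u = s \<odot>\<^bsub>module_sum M N\<^esub> v \<and>
      r \<odot>\<^bsub>module_sum M N\<^esub> u \<noteq> \<zero>\<^bsub>module_sum M N\<^esub>"
    by (intro bexI[of _ r] bexI[of _ s]) (simp_all add: xy module_sum_sel)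
qed

lemma uniform_part_mono:
  assumes "uniform_part R M V" "U \<subseteq> V"
  shows "uniform_part R M U"
  using assms unfolding uniform_part_def by blast

lemma (in cring) separating_idempotent_imp_strongly_CS_sum:
  assumes P: "primeideal P R" and P': "primeideal P' R" and e: "separating_idempotent R P P' e"
  shows "strongly_CS R (module_sum (quot_module R P) (quot_module R P'))"
proof -
  interpret P: primeideal P R by fact
  interpret P': primeideal P' R by fact
  let ?M = "quot_module R P" and ?M' = "quot_module R P'"
  note mods = quot_module_is_module[OF P.is_ideal] quot_module_is_module[OF P'.is_ideal]
  interpret S: module R "module_sum ?M ?M'" by (rule module_sum_is_module[OF mods])
  have e': "idempotent_in R e" "e \<in> carrier R" "e \<in> P" "\<one> \<ominus> e \<in> P'"
    using e by (auto simp: separating_idempotent_def idempotent_in_def)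
  interpret M: module R ?M by (rule mods)
  interpret M': module R ?M' by (rule mods)
  show ?thesis
  proof (rule S.strongly_CS_if_uniform_split[OF e'(1)])
    show "uniform_part R (module_sum ?M ?M')
        ((\<lambda>x. e \<odot>\<^bsub>module_sum ?M ?M'\<^esub> x) ` carrier (module_sum ?M ?M'))"
      by (rule uniform_part_mono[OF uniform_part_sum_right[OF mods(1) P'.quot_module_uniform]])
        (use e' in \<open>auto simp: module_sum_sel quot_module_zero P.quot_module_smult_zero\<close>)
    show "uniform_part R (module_sum ?M ?M')
        ((\<lambda>x. (\<one> \<ominus> e) \<odot>\<^bsub>module_sum ?M ?M'\<^esub> x) ` carrier (module_sum ?M ?M'))"
      by (rule uniform_part_mono[OF uniform_part_sum_left[OF mods(2) P.quot_module_uniform]])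
        (use e' in \<open>auto simp: module_sum_sel quot_module_zero P'.quot_module_smult_zero\<close>)
  qed
qed

lemma module_sum_summand_submodule:
  assumes M: "module R M" and N: "module R N"
  shows "submodule (carrier M \<times> {\<zero>\<^bsub>N\<^esub>}) R (module_sum M N)"
    "submodule ({\<zero>\<^bsub>M\<^esub>} \<times> carrier N) R (module_sum M N)"
proof -
  interpret M: module R M by fact
  interpret N: module R N by fact
  interpret S: module R "module_sum M N" by (rule module_sum_is_module[OF M N])
  \<comment> \<open>Negation in the direct sum is computed as the action of \<open>-1\<close>.\<close>
  have neg: "\<ominus>\<^bsub>module_sum M N\<^esub> (x, y) = (\<ominus>\<^bsub>M\<^esub> x, \<ominus>\<^bsub>N\<^esub> y)"
    if "x \<in> carrier M" "y \<in> carrier N" for x y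
    using that S.smult_l_minus[of "\<one>\<^bsub>R\<^esub>" "(x, y)"] M.smult_l_minus[of "\<one>\<^bsub>R\<^esub>" x]
      N.smult_l_minus[of "\<one>\<^bsub>R\<^esub>" y] by (simp add: module_sum_sel)
  show "submodule (carrier M \<times> {\<zero>\<^bsub>N\<^esub>}) R (module_sum M N)"
    by (rule S.submoduleI) (auto simp: module_sum_sel neg)
  show "submodule ({\<zero>\<^bsub>M\<^esub>} \<times> carrier N) R (module_sum M N)"
    by (rule S.submoduleI) (auto simp: module_sum_sel neg)
qed

text \<open>The idempotent found for the submodule \<open>R/P \<oplus> 0\<close> is \<open>1\<close> modulo \<open>P\<close> since it fixes the residue
  of \<open>1\<close>, and \<open>0\<close> modulo \<open>P'\<close> since otherwise \<open>R/P \<oplus> 0\<close> would be essential in the whole sum.\<close>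

lemma (in cring) strongly_CS_sum_imp_separating_idempotent:
  assumes P: "primeideal P R" and P': "primeideal P' R"
    and CS: "strongly_CS R (module_sum (quot_module R P) (quot_module R P'))"
  shows "\<exists>e. separating_idempotent R P P' e"
proof -
  interpret P: primeideal P R by fact
  interpret P': primeideal P' R by fact
  let ?M = "quot_module R P" and ?M' = "quot_module R P'"
  let ?S = "module_sum ?M ?M'"
  let ?N = "carrier ?M \<times> {\<zero>\<^bsub>?M'\<^esub>}" and ?L = "{\<zero>\<^bsub>?M\<^esub>} \<times> carrier ?M'"
  note mods = quot_module_is_module[OF P.is_ideal] quot_module_is_module[OF P'.is_ideal]
  interpret M: module R ?M by (rule mods)
  interpret M': module R ?M' by (rule mods)
  interpret S: module R ?S by (rule module_sum_is_module[OF mods])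
  note sub = module_sum_summand_submodule[OF mods]
  obtain f where f: "idempotent_in R f"
    and ess: "essential_submodule R ?S ?N ((\<lambda>x. f \<odot>\<^bsub>?S\<^esub> x) ` carrier ?S)"
    using CS[unfolded strongly_CS_def, THEN conjunct2, rule_format, OF sub(1)] by (elim exE conjE)
  have NK: "?N \<subseteq> (\<lambda>x. f \<odot>\<^bsub>?S\<^esub> x) ` carrier ?S"
    and trivial: "\<And>L. \<lbrakk>submodule L R ?S; L \<subseteq> (\<lambda>x. f \<odot>\<^bsub>?S\<^esub> x) ` carrier ?S; L \<inter> ?N = {\<zero>\<^bsub>?S\<^esub>}\<rbrakk>
      \<Longrightarrow> L = {\<zero>\<^bsub>?S\<^esub>}"
    using ess by (simp_all add: essential_submodule_def)
  have fc: "f \<in> carrier R" using f by (simp add: idempotent_in_def)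
  have "\<one> \<ominus> f \<in> P"
  proof (rule ccontr)
    assume "\<one> \<ominus> f \<notin> P"
    then have "f \<in> P" using P.idempotent_cases[OF f] by blast
    have one: "P +> \<one> \<in> carrier ?M" by (simp add: P.coset_in_quot_module)
    then have "(P +> \<one>, \<zero>\<^bsub>?M'\<^esub>) \<in> (\<lambda>x. f \<odot>\<^bsub>?S\<^esub> x) ` carrier ?S"
      by (intro subsetD[OF NK]) simp
    then obtain x where "x \<in> carrier ?M" "P +> \<one> = f \<odot>\<^bsub>?M\<^esub> x"
      by (auto simp: module_sum_sel)
    then have "P +> \<one> = P" using \<open>f \<in> P\<close> by (simp add: P.quot_module_smult_zero)
    then show False using P.one_notin by (simp add: P.coset_eq_zero_iff)
  qed
  moreover have "f \<in> P'"
  proof (rule ccontr)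
    assume "f \<notin> P'"
    then have f': "\<one> \<ominus> f \<in> P'" using P'.idempotent_cases[OF f] by blast
    have "?L \<subseteq> (\<lambda>x. f \<odot>\<^bsub>?S\<^esub> x) ` carrier ?S"
    proof
      fix z assume "z \<in> ?L"
      then show "z \<in> (\<lambda>x. f \<odot>\<^bsub>?S\<^esub> x) ` carrier ?S"
        using f' fc by (intro image_eqI[of _ _ z]) (auto simp: module_sum_sel P'.quot_module_smult_id)
    qed
    moreover have "?L \<inter> ?N = {\<zero>\<^bsub>?S\<^esub>}" by (auto simp: module_sum_sel)
    ultimately have "?L = {\<zero>\<^bsub>?S\<^esub>}"
      by (rule trivial[OF sub(2)])
    moreover have "(\<zero>\<^bsub>?M\<^esub>, P' +> \<one>) \<in> ?L" by (simp add: P'.coset_in_quot_module)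
    ultimately have "P' +> \<one> = P'" by (simp add: module_sum_sel quot_module_zero)
    then show False using P'.one_notin by (simp add: P'.coset_eq_zero_iff)
  qed
  ultimately have "separating_idempotent R P' P f" using f by (simp add: separating_idempotent_def)
  then show ?thesis using separating_idempotent_sym by blast
qed

theorem theorem3p9:
  fixes R :: "('a, 'm) ring_scheme"
  assumes "cring R"
  shows
    "((\<forall>P P'. minimal_prime P R \<longrightarrow> minimal_prime P' R \<longrightarrow> P \<noteq> P' \<longrightarrow>
         strongly_CS R (module_sum (quot_module R P) (quot_module R P')))
      \<longleftrightarrow>
      (mp_ring R \<and>
       (\<forall>P P'. minimal_prime P R \<longrightarrow> minimal_prime P' R \<longrightarrow> P \<noteq> P' \<longrightarrow>
         idempotents_lift R (P \<inter> P'))))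
     \<and>
     ((mp_ring R \<and>
       (\<forall>P P'. minimal_prime P R \<longrightarrow> minimal_prime P' R \<longrightarrow> P \<noteq> P' \<longrightarrow>
         idempotents_lift R (P \<inter> P')))
      \<longleftrightarrow> purified_ring R)"
proof -
  interpret cring R by fact
  have "(\<forall>P P'. minimal_prime P R \<longrightarrow> minimal_prime P' R \<longrightarrow> P \<noteq> P' \<longrightarrow>
      strongly_CS R (module_sum (quot_module R P) (quot_module R P'))) \<longleftrightarrow> purified_ring R"
    using strongly_CS_sum_imp_separating_idempotent separating_idempotent_imp_strongly_CS_sum
    unfolding purified_iff minimal_prime_def by meson
  then show ?thesis using mp_and_lift_iff_purified by blast
qed

end
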